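(* Let $V$ be a vector space over a field, let $W$ be a subspace of $V$, and let $f\in\overline{L}(V,W)$. Then $f$ is unit-regular in $\overline{L}(V,W)$ if and only if the following three conditions hold: (i) $R(f_{\upharpoonright_W}) = W\cap R(f)$; (ii) $\operatorname{nullity}(f_{\upharpoonright_W}) = \operatorname{corank}(f_{\upharpoonright_W})$; (iii) there exists a subspace $T_f$ of $V$ such that $T_f$ is a transversal of $\ker(f)$, $W\cap T_f$ is a transversal of $\ker(f_{\upharpoonright_W})$, and $\operatorname{codim}_V(W+T_f) = \operatorname{codim}_V(W+R(f))$.
   Context: Maps are written on the right and composed from left to right. $L(V)$ is the semigroup of all linear maps $V\to V$ under composition, and $\overline{L}(V,W)=\{f\in L(V) : Wf\subseteq W\}$, a subsemigroup containing the identity. An element $s$ of a semigroup $S$ with identity is unit-regular in $S$ if there is a unit $u$ of $S$ with $sus=s$. For $f\in\overline{L}(V,W)$, $f_{\upharpoonright_W}\in L(W)$ is the linear map $W\to W$ that agrees with $f$ on $W$. For a vector space $U$ and $h\in L(U)$: $R(h)=Uh$ is the range, $N(h)=\{u\in U: uh=0\}$, $\operatorname{nullity}(h)=\dim N(h)$, $\operatorname{corank}(h)=\dim(U/R(h))$ (so $\operatorname{corank}(f_{\upharpoonright_W})=\dim(W/R(f_{\upharpoonright_W}))$), and $\ker(h)$ is the equivalence relation $\{(x,y)\in U\times U : xh=yh\}$ (not the null space). $\operatorname{codim}_V(U)=\dim(V/U)$. A transversal of an equivalence relation is a subset containing exactly one element of each class. Vector spaces may be infinite-dimensional; dimensions are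 cardinal numbers. *)

theory Defs
  imports
    HOL.Vector_Spaces
    "HOL-Library.Set_Algebras"
    "HOL-Algebra.Group"
begin

no_notation elt_set_eq (infix \<open>=o\<close> 50)
unbundle cardinal_syntax

definition unit_regular :: "('m, 'n) monoid_scheme \<Rightarrow> 'm \<Rightarrow> bool"
  where "unit_regular S s \<longleftrightarrow>
    s \<in> carrier S \<and> (\<exists>u\<in>Units S. s \<otimes>\<^bsub>S\<^esub> u \<otimes>\<^bsub>S\<^esub> s = s)"

definition transversal :: "'b set \<Rightarrow> ('b \<times> 'b) set \<Rightarrow> 'b set \<Rightarrow> bool"
  where "transversal U r T \<longleftrightarrow> T \<subseteq> U \<and> (\<forall>X \<in> U // r. \<exists>!t. t \<in> X \<inter> T)"

text \<open>
  The following notions are for maps \<open>h : U \<rightarrow> U\<close>, represented by HOL functions of which only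
  the values on \<open>U\<close> matter.
\<close>

definition range_of :: "'b set \<Rightarrow> ('b \<Rightarrow> 'b) \<Rightarrow> 'b set"
  where "range_of U h = h ` U"

definition null_space :: "'b set \<Rightarrow> ('b \<Rightarrow> 'b::zero) \<Rightarrow> 'b set"
  where "null_space U h = {x \<in> U. h x = 0}"

definition ker_rel :: "'b set \<Rightarrow> ('b \<Rightarrow> 'b) \<Rightarrow> ('b \<times> 'b) set"
  where "ker_rel U h = {(x, y) \<in> U \<times> U. h x = h y}"

definition quotient_space :: "'b set \<Rightarrow> 'b set \<Rightarrow> 'b::ab_group_add set set"
  where "quotient_space A U = (\<lambda>x. x +o U) ` A"

text \<open>Maps are composed from left to right.\<close>

definition Lbar :: "('a::field \<Rightarrow> 'b::ab_group_add \<Rightarrow> 'b) \<Rightarrow> 'b set \<Rightarrow> ('b \<Rightarrow> 'b) monoid"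
  where "Lbar scale W =
    \<lparr>carrier = {f. Vector_Spaces.linear scale scale f \<and> f ` W \<subseteq> W},
     mult = (\<lambda>f g. g \<circ> f), one = id\<rparr>"

text \<open>
  The dimension of a subspace \<open>A\<close> as a cardinal, i.e. the cardinality of a basis. (The library's
  \<^const>\<open>vector_space.dim\<close> is \<open>0\<close> in infinite dimension.)
\<close>

definition basis_of :: "('a::field \<Rightarrow> 'b::ab_group_add \<Rightarrow> 'b) \<Rightarrow> 'b set \<Rightarrow> 'b set \<Rightarrow> bool"
  where "basis_of scale A B \<longleftrightarrow> B \<subseteq> A \<and> \<not> module.dependent scale B \<and> module.span scale B = A"

definition cdim :: "('a::field \<Rightarrow> 'b::ab_group_add \<Rightarrow> 'b) \<Rightarrow> 'b set \<Rightarrow> 'b rel"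
  where "cdim scale A = |SOME B. basis_of scale A B|"

text \<open>
  The vector space \<open>A / U\<close> of cosets, for subspaces \<open>U \<subseteq> A\<close>: its addition is the elementwise
  sum of sets and its zero is \<open>U\<close>. The summand \<open>U\<close> in a scalar multiple makes \<open>0 \<cdot> X = U\<close> instead
  of \<open>{0}\<close>, and in a linear combination it makes the empty combination \<open>U\<close>, the sum of an
  empty family of sets being \<open>{0}\<close> here.
\<close>

definition quotient_scale ::
    "('a::field \<Rightarrow> 'b::ab_group_add \<Rightarrow> 'b) \<Rightarrow>
      'b set \<Rightarrow> 'a \<Rightarrow> 'b set \<Rightarrow> 'b set"
  where "quotient_scale scale U a X = scale a ` X + U"

definition quotient_lincomb ::
    "('a::field \<Rightarrow> 'b::ab_group_add \<Rightarrow> 'b) \<Rightarrow>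
      'b set \<Rightarrow> ('b set \<Rightarrow> 'a) \<Rightarrow> 'b set set \<Rightarrow> 'b set"
  where "quotient_lincomb scale U c F = U + (\<Sum>X\<in>F. quotient_scale scale U (c X) X)"

definition quotient_independent ::
    "('a::field \<Rightarrow> 'b::ab_group_add \<Rightarrow> 'b) \<Rightarrow>
      'b set \<Rightarrow> 'b set set \<Rightarrow> bool"
  where "quotient_independent scale U C \<longleftrightarrow>
    (\<forall>F c. finite F \<and> F \<subseteq> C \<and> quotient_lincomb scale U c F = U \<longrightarrow> (\<forall>X\<in>F. c X = 0))"

definition quotient_span ::
    "('a::field \<Rightarrow> 'b::ab_group_add \<Rightarrow> 'b) \<Rightarrow>
      'b set \<Rightarrow> 'b set set \<Rightarrow> 'b set set"
  where "quotient_span scale U C = {quotient_lincomb scale U c F | c F. finite F \<and> F \<subseteq> C}"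

definition quotient_basis_of ::
    "('a::field \<Rightarrow> 'b::ab_group_add \<Rightarrow> 'b) \<Rightarrow>
      'b set \<Rightarrow> 'b set \<Rightarrow> 'b set set \<Rightarrow> bool"
  where "quotient_basis_of scale A U C \<longleftrightarrow>
    C \<subseteq> quotient_space A U \<and> quotient_independent scale U C \<and> quotient_span scale U C = quotient_space A U"

definition quotient_cdim ::
    "('a::field \<Rightarrow> 'b::ab_group_add \<Rightarrow> 'b) \<Rightarrow>
      'b set \<Rightarrow> 'b set \<Rightarrow> 'b set rel"
  where "quotient_cdim scale A U = |SOME C. quotient_basis_of scale A U C|"

definition nullity :: "('a::field \<Rightarrow> 'b::ab_group_add \<Rightarrow> 'b) \<Rightarrow> 'b set \<Rightarrow> ('b \<Rightarrow> 'b) \<Rightarrow> 'b rel"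
  where "nullity scale U h = cdim scale (null_space U h)"

definition corank ::
    "('a::field \<Rightarrow> 'b::ab_group_add \<Rightarrow> 'b) \<Rightarrow>
      'b set \<Rightarrow> ('b \<Rightarrow> 'b) \<Rightarrow> 'b set rel"
  where "corank scale U h = quotient_cdim scale U (range_of U h)"

definition codim :: "('a::field \<Rightarrow> 'b::ab_group_add \<Rightarrow> 'b) \<Rightarrow> 'b set \<Rightarrow> 'b set rel"
  where "codim scale U = quotient_cdim scale UNIV U"

text \<open>Bases exist, both of subspaces and of quotients.\<close>

context vector_space
begin

lemma ex_basis_of:
  assumes "subspace A"
  shows "\<exists>B. basis_of scale A B"
proof -
  obtain B where "B \<subseteq> A" "independent B" "A \<subseteq> span B"
    using maximal_independent_subset[of A] by blast
  with assms show ?thesis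
    unfolding basis_of_def by (meson span_minimal subset_antisym)
qed

lemma coset_add:
  assumes "subspace U"
  shows "(x +o U) + (y +o U) = (x + y) +o U"
proof -
  have "U + U = U"
    using assms by (auto simp: set_plus_def subspace_add) (metis add.right_neutral subspace_0)
  then show ?thesis
    by (simp add: set_plus_rearrange)
qed

lemma quotient_scale_coset:
  assumes "subspace U"
  shows "quotient_scale scale U a (x +o U) = scale a x +o U"
proof
  show "quotient_scale scale U a (x +o U) \<subseteq> scale a x +o U"
  proof
    fix z assume "z \<in> quotient_scale scale U a (x +o U)"
    then obtain u v where uv: "u \<in> U" "v \<in> U" "z = scale a (x + u) + v"
      by (auto simp: quotient_scale_def set_plus_def elt_set_plus_def)
    then have "z = scale a x + (scale a u + v)"
      by (simp add: scale_right_distrib add.assoc)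
    moreover have "scale a u + v \<in> U"
      using uv assms by (simp add: subspace_add subspace_scale)
    ultimately show "z \<in> scale a x +o U"
      by blast
  qed
  show "scale a x +o U \<subseteq> quotient_scale scale U a (x +o U)"
  proof
    fix z assume "z \<in> scale a x +o U"
    then obtain v where "v \<in> U" "z = scale a x + v"
      by (auto simp: elt_set_plus_def)
    moreover have "x \<in> x +o U"
      using subspace_0[OF assms] by (force simp: elt_set_plus_def)
    ultimately show "z \<in> quotient_scale scale U a (x +o U)"
      by (auto simp: quotient_scale_def)
  qed
qed

lemma quotient_lincomb_cosets:
  assumes "subspace U" and "finite F" and "\<And>X. X \<in> F \<Longrightarrow> X = r X +o U"
  shows "quotient_lincomb scale U c F = (\<Sum>X\<in>F. scale (c X) (r X)) +o U"
  using assms(2,3)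
proof (induction F)
  case empty
  then show ?case by (simp add: quotient_lincomb_def)
next
  case (insert X F)
  have X: "quotient_scale scale U (c X) X = scale (c X) (r X) +o U"
    using quotient_scale_coset[OF assms(1), of "c X" "r X"] insert.prems[of X] by simp
  have "quotient_lincomb scale U c (insert X F) = quotient_scale scale U (c X) X + quotient_lincomb scale U c F"
    using insert.hyps by (simp add: quotient_lincomb_def ac_simps)
  also have "\<dots> = (scale (c X) (r X) + (\<Sum>X\<in>F. scale (c X) (r X))) +o U"
    using insert by (simp add: X coset_add[OF assms(1)])
  finally show ?case
    using insert.hyps by simp
qed

lemma coset_eq_iff:
  assumes "subspace U"
  shows "x +o U = y +o U \<longleftrightarrow> x - y \<in> U"
proof
  assume "x +o U = y +o U"
  moreover have "x \<in> x +o U"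
    using subspace_0[OF assms] by (force simp: elt_set_plus_def)
  ultimately show "x - y \<in> U"
    by (simp add: set_minus_plus)
next
  assume xy: "x - y \<in> U"
  have "z - x \<in> U \<longleftrightarrow> z - y \<in> U" for z
    using subspace_add[OF assms, of "z - x" "x - y"] subspace_diff[OF assms, of "z - y" "x - y"] xy
    by auto
  then show "x +o U = y +o U"
    by (auto simp flip: set_minus_plus)
qed

lemma ex_quotient_basis_of:
  assumes A: "subspace A" and U: "subspace U" and "U \<subseteq> A"
  shows "\<exists>C. quotient_basis_of scale A U C"
proof -
  obtain B0 where B0: "B0 \<subseteq> U" "independent B0" "span B0 = U"
    using ex_basis_of[OF U] by (auto simp: basis_of_def)
  obtain B where B: "B0 \<subseteq> B" "B \<subseteq> A" "independent B" "A \<subseteq> span B"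
    using maximal_independent_subset_extend[of B0 A] B0 \<open>U \<subseteq> A\<close> by (metis order_trans)
  define D where "D = B - B0"
  define r where "r X = (SOME x. x \<in> D \<and> X = x +o U)" for X
  let ?C = "(\<lambda>x. x +o U) ` D"
  have indep: "\<forall>x\<in>t. c x = 0"
    if t: "finite t" "t \<subseteq> D" and s: "(\<Sum>x\<in>t. scale (c x) x) \<in> U" for t c
  proof
    fix x assume "x \<in> t"
    obtain s q where s: "finite s" "s \<subseteq> B0" "(\<Sum>x\<in>t. scale (c x) x) = (\<Sum>x\<in>s. scale (q x) x)"
      using s unfolding B0(3)[symmetric] span_explicit by auto
    have disj: "t \<inter> s = {}"
      using t s by (auto simp: D_def)
    let ?u = "\<lambda>v. if v \<in> t then c v else - q v"
    have "(\<Sum>v\<in>t \<union> s. scale (?u v) v) = (\<Sum>v\<in>t. scale (?u v) v) + (\<Sum>v\<in>s. scale (?u v) v)"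
      using t s disj by (intro sum.union_disjoint) auto
    also have "(\<Sum>v\<in>t. scale (?u v) v) = (\<Sum>v\<in>t. scale (c v) v)"
      by simp
    also have "(\<Sum>v\<in>s. scale (?u v) v) = - (\<Sum>v\<in>s. scale (q v) v)"
      using disj by (subst sum_negf[symmetric], intro sum.cong) auto
    finally have "(\<Sum>v\<in>t \<union> s. scale (?u v) v) = 0"
      using s by simp
    moreover have "t \<union> s \<subseteq> B"
      using t s B by (auto simp: D_def)
    ultimately have "?u x = 0"
      using independentD[OF B(3), of "t \<union> s" ?u x] t s \<open>x \<in> t\<close> by blast
    then show "c x = 0"
      using \<open>x \<in> t\<close> by simp
  qed
  have r: "r X \<in> D \<and> X = r X +o U" if "X \<in> ?C" for X
    unfolding r_def by (rule someI_ex) (use that in blast)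
  have r_inj: "inj_on r ?C"
    by (rule inj_onI) (metis r)
  have lc: "quotient_lincomb scale U c F = (\<Sum>X\<in>F. scale (c X) (r X)) +o U"
    if "finite F" "F \<subseteq> ?C" for c F
    using that r by (intro quotient_lincomb_cosets[OF U]) auto
  have "quotient_independent scale U ?C"
    unfolding quotient_independent_def
  proof (intro allI impI)
    fix F c assume *: "finite F \<and> F \<subseteq> ?C \<and> quotient_lincomb scale U c F = U"
    have "(\<Sum>X\<in>F. scale (c X) (r X)) +o U = 0 +o U"
      using lc[of F c] * by simp
    then have mem: "(\<Sum>X\<in>F. scale (c X) (r X)) \<in> U"
      unfolding coset_eq_iff[OF U] by simp
    have inj: "inj_on r F"
      using r_inj * inj_on_subset by blast
    have "(\<Sum>x\<in>r ` F. scale (c (inv_into F r x)) x) = (\<Sum>X\<in>F. scale (c X) (r X))"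
      using inj by (simp add: sum.reindex)
    then have "\<forall>x\<in>r ` F. c (inv_into F r x) = 0"
      using mem * r by (intro indep) auto
    then show "\<forall>X\<in>F. c X = 0"
      using inj by simp
  qed
  moreover have C: "?C \<subseteq> quotient_space A U"
    using B by (auto simp: quotient_space_def D_def)
  moreover have "quotient_span scale U ?C = quotient_space A U"
  proof
    show "quotient_span scale U ?C \<subseteq> quotient_space A U"
    proof
      fix Y assume "Y \<in> quotient_span scale U ?C"
      then obtain c F where F: "finite F" "F \<subseteq> ?C" "Y = quotient_lincomb scale U c F"
        by (auto simp: quotient_span_def)
      have "(\<Sum>X\<in>F. scale (c X) (r X)) \<in> A"
        using F r B(2) D_def by (intro subspace_sum[OF A] subspace_scale[OF A]) blast
      then show "Y \<in> quotient_space A U"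
        using F lc by (auto simp: quotient_space_def)
    qed
    show "quotient_space A U \<subseteq> quotient_span scale U ?C"
    proof
      fix Y assume "Y \<in> quotient_space A U"
      then obtain a where a: "a \<in> A" "Y = a +o U"
        by (auto simp: quotient_space_def)
      have "a \<in> span (D \<union> B0)"
        using a B by (auto simp: D_def Un_absorb2)
      then obtain d u where du: "d \<in> span D" "u \<in> U" "a = d + u"
        using B0(3) unfolding span_Un by auto
      then obtain t c where t: "finite t" "t \<subseteq> D" "d = (\<Sum>x\<in>t. scale (c x) x)"
        by (auto simp: span_explicit)
      have inj: "inj_on (\<lambda>x. x +o U) D"
      proof (rule inj_onI, rule ccontr)
        fix x y assume xy: "x \<in> D" "y \<in> D" "x +o U = y +o U" "x \<noteq> y"
        have "(\<Sum>z\<in>{x, y}. scale (if z = x then 1 else - 1) z) = x - y"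
          using xy by simp
        then have "\<forall>z\<in>{x, y}. (if z = x then 1 else - 1 :: 'a) = 0"
          using xy coset_eq_iff[OF U] by (intro indep) auto
        then show False by simp
      qed
      have rx: "r (x +o U) = x" if "x \<in> D" for x
        using r[of "x +o U"] inj that by (auto dest: inj_onD)
      have inj_t: "inj_on (\<lambda>x. x +o U) t"
        using inj t inj_on_subset by blast
      let ?F = "(\<lambda>x. x +o U) ` t"
      have "quotient_lincomb scale U (c \<circ> r) ?F = (\<Sum>X\<in>?F. scale ((c \<circ> r) X) (r X)) +o U"
        using t by (intro lc) auto
      also have "(\<Sum>X\<in>?F. scale ((c \<circ> r) X) (r X)) = d"
        unfolding t(3) sum.reindex[OF inj_t] using rx t by (intro sum.cong) auto
      also have "d +o U = Y"
        using du a coset_eq_iff[OF U, of d a] subspace_neg[OF U] by simp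
      finally show "Y \<in> quotient_span scale U ?C"
        using t unfolding quotient_span_def by blast
    qed
  qed
  ultimately show ?thesis
    unfolding quotient_basis_of_def by blast
qed

end

end

theory Submission
  imports Defs
begin

text \<open>
  Write \<open>R\<close> for the range of \<open>f\<close> and \<open>N\<close> for the null space of \<open>f\<close> on \<open>W\<close>. The units are the linear
  bijections \<open>u\<close> with \<open>u(W) = W\<close>. If \<open>f u f = f\<close>, then \<open>T = u(R)\<close> is the required transversal:
  \<open>W \<inter> T = u(f(W))\<close> is a complement of \<open>N\<close> in \<open>W\<close>, and \<open>u\<close> carries \<open>f(W)\<close> to \<open>W \<inter> T\<close> and \<open>W + R\<close> to
  \<open>W + T\<close>. Conversely, the inverse \<open>R \<rightarrow> T\<close> of \<open>f\<close> on \<open>T\<close> maps \<open>W \<inter> R\<close> onto \<open>W \<inter> T\<close>. By (ii) it extends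
  to an isomorphism \<open>W + R \<rightarrow> W + T\<close> taking a complement of \<open>f(W)\<close> in \<open>W\<close> to \<open>N\<close>, hence \<open>W\<close> onto \<open>W\<close>;
  by equality of the codimensions this extends further to an automorphism of the whole space.
\<close>

context vector_space
begin

section \<open>Internal direct sums and complements\<close>

lemma independent_Un_span_Int:
  assumes B: "independent B" and C: "independent C" and BC: "span B \<inter> span C = {0}"
  shows "independent (B \<union> C)"
  unfolding independent_explicit_module
proof (intro allI impI)
  fix t c x
  assume t: "finite t" "t \<subseteq> B \<union> C" and sum: "(\<Sum>v\<in>t. scale (c v) v) = 0" and x: "x \<in> t"
  let ?s = "\<lambda>S. \<Sum>v\<in>S. scale (c v) v"
  have split: "?s (t \<inter> B) + ?s (t - B) = 0"
    using sum.Int_Diff[OF t(1), of "\<lambda>v. scale (c v) v" B] sum by simp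
  have 1: "?s (t \<inter> B) \<in> span B"
    by (intro span_sum span_scale span_base) auto
  have 2: "?s (t - B) \<in> span C"
    using t(2) by (intro span_sum span_scale span_base) auto
  have "?s (t \<inter> B) = - ?s (t - B)"
    using split by (simp add: eq_neg_iff_add_eq_0)
  \<comment> \<open>The part over \<open>B\<close> is the negative of the part over
    \<open>C\<close>, so it lies in both spans and vanishes.\<close>
  then have "?s (t \<inter> B) \<in> span C"
    using 2 span_neg by metis
  with 1 BC have zB: "?s (t \<inter> B) = 0"
    by blast
  with split have zC: "?s (t - B) = 0"
    by simp
  show "c x = 0"
  proof (cases "x \<in> B")
    case True
    then show ?thesis
      using independentD[OF B _ _ zB, of x] t x by auto
  next
    case False
    then show ?thesis
      using independentD[OF C _ _ zC, of x] t x by auto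
  qed
qed

text \<open>The ambient space comes first and the chosen complement last. Dimensions of quotients
  are compared below through complements \<open>D\<close>, which are subspaces of the same
  space.\<close>

definition direct_sum :: "'b set \<Rightarrow> 'b set \<Rightarrow> 'b set \<Rightarrow> bool"
  where "direct_sum A U D \<longleftrightarrow> subspace U \<and> subspace D \<and> U \<inter> D = {0} \<and> U + D = A"

lemma subspace_set_plus:
  assumes "subspace U" "subspace D"
  shows "subspace (U + D)"
proof -
  have "U + D = {x + y |x y. x \<in> U \<and> y \<in> D}"
    by (auto simp: set_plus_def)
  with subspace_sums[OF assms] show ?thesis
    by simp
qed

text \<open>A basis \<open>B0\<close> of \<open>U\<close> extends to a basis \<open>B\<close> of
  \<open>A\<close>; the vectors added span a complement.\<close>

lemma ex_direct_sum:
  assumes U: "subspace U" and A: "subspace A" and UA: "U \<subseteq> A"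
  shows "\<exists>D. direct_sum A U D"
proof -
  obtain B0 where B0: "B0 \<subseteq> U" "independent B0" "span B0 = U"
    using ex_basis_of[OF U] by (auto simp: basis_of_def)
  obtain B where B: "B0 \<subseteq> B" "B \<subseteq> A" "independent B" "A \<subseteq> span B"
    using maximal_independent_subset_extend[of B0 A] B0 UA by (metis order_trans)
  have BA: "span B = A"
    using B A by (meson span_minimal subset_antisym)
  interpret p: vector_space_pair scale scale ..
  \<comment> \<open>On \<open>A\<close>, \<open>g\<close> is the projection onto \<open>U\<close>
    along \<open>span (B - B0)\<close>: a vector in both subspaces is fixed by \<open>g\<close> and
    also sent to 0.\<close>
  obtain g where g: "Vector_Spaces.linear scale scale g" "\<And>b. b \<in> B \<Longrightarrow> g b = (if b \<in> B0 then b else 0)"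
    using p.linear_independent_extend[OF B(3), of "\<lambda>b. if b \<in> B0 then b else 0"] by blast
  have "x = 0" if "x \<in> U" "x \<in> span (B - B0)" for x
  proof -
    have "g x = x"
    proof (rule p.linear_eq_on[OF g(1) linear_ident])
      show "x \<in> span B0"
        using that B0(3) by simp
      show "g b = b" if "b \<in> B0" for b
        using that g(2) B(1) by auto
    qed
    moreover have "g x = 0"
      by (rule p.linear_eq_0_on_span[OF g(1) _ that(2)]) (simp add: g(2))
    ultimately show ?thesis
      by simp
  qed
  then have "U \<inter> span (B - B0) = {0}"
    using subspace_0[OF U] subspace_0 by auto
  moreover have "U + span (B - B0) = A"
    using span_Un[of B0 "B - B0"] B(1) BA B0(3) by (auto simp: set_plus_def Un_absorb1)
  ultimately show ?thesis
    using U unfolding direct_sum_def by blast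
qed

section \<open>Dimension of a quotient as dimension of a complement\<close>

lemma basis_of_ordIso_cdim:
  assumes "basis_of scale A B"
  shows "|B| =o cdim scale A"
proof -
  \<comment> \<open>The given basis makes the choice in \<open>cdim\<close> succeed; two bases with
    the same span are equipotent.\<close>
  have "basis_of scale A (SOME B. basis_of scale A B)"
    using assms by (rule someI)
  with assms have "\<exists>f. bij_betw f B (SOME B. basis_of scale A B)"
    by (intro bij_if_span_eq_span_bases) (auto simp: basis_of_def)
  then show ?thesis
    by (simp add: cdim_def card_of_ordIso)
qed

text \<open>Each coset of \<open>U\<close> meets a complement \<open>D\<close> in one point, which turns a basis of the quotient
  into a basis of \<open>D\<close>.\<close>

lemma quotient_cdim_direct_sum:
  assumes "direct_sum A U D"
  shows "quotient_cdim scale A U =o cdim scale D"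
proof -
  from assms have U: "subspace U" and D: "subspace D" and UD: "U \<inter> D = {0}" and A: "U + D = A"
    by (auto simp: direct_sum_def)
  have "subspace A"
    using subspace_set_plus[OF U D] A by simp
  have "U \<subseteq> A" "D \<subseteq> A"
    using set_zero_plus2[of U D] set_zero_plus2[of D U] A subspace_0[OF U] subspace_0[OF D]
    by (simp_all add: add.commute)
  define C where "C = (SOME C. quotient_basis_of scale A U C)"
  have "quotient_basis_of scale A U C"
    unfolding C_def using ex_quotient_basis_of[OF \<open>subspace A\<close> U \<open>U \<subseteq> A\<close>] by (rule someI_ex)
  then have C: "C \<subseteq> quotient_space A U" and indep: "quotient_independent scale U C"
    and span: "quotient_span scale U C = quotient_space A U"
    by (auto simp: quotient_basis_of_def)
  have "\<exists>d. d \<in> D \<and> X = d +o U" if "X \<in> C" for X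
  proof -
    obtain a where "a \<in> A" and X: "X = a +o U"
      using \<open>X \<in> C\<close> C unfolding quotient_space_def by blast
    then obtain u d where "u \<in> U" "d \<in> D" "a = u + d"
      using A by (auto simp: set_plus_def)
    then show ?thesis
      using X coset_eq_iff[OF U, of a d] by auto
  qed
  then obtain r where r: "\<And>X. X \<in> C \<Longrightarrow> r X \<in> D" "\<And>X. X \<in> C \<Longrightarrow> X = r X +o U"
    by metis
  have inj: "inj_on r C"
    using r(2) by (metis inj_onI)
  have lc: "quotient_lincomb scale U c F = (\<Sum>X\<in>F. scale (c X) (r X)) +o U"
    if "finite F" "F \<subseteq> C" for c F
    using that r by (intro quotient_lincomb_cosets[OF U]) auto
  have "independent (r ` C)"
    unfolding independent_explicit_module
  proof (intro allI impI)
    fix t c x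
    assume t: "finite t" "t \<subseteq> r ` C" and sum: "(\<Sum>v\<in>t. scale (c v) v) = 0" and x: "x \<in> t"
    obtain F where F: "F \<subseteq> C" "finite F" "t = r ` F"
      using t by (metis finite_subset_image)
    \<comment> \<open>Reindexing along the injective \<open>r\<close> turns a relation among
      representatives into one among cosets, where \<open>X\<close> has coefficient
      \<open>c (r X)\<close>.\<close>
    have "(\<Sum>X\<in>F. scale ((c \<circ> r) X) (r X)) = 0"
      using sum F inj by (simp add: sum.reindex inj_on_subset)
    then have "quotient_lincomb scale U (c \<circ> r) F = U"
      using lc[OF F(2,1), of "c \<circ> r"] by simp
    then have "\<forall>X\<in>F. (c \<circ> r) X = 0"
      using indep F by (meson quotient_independent_def)
    then show "c x = 0"
      using x F by auto
  qed
  moreover have "span (r ` C) = D"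
  proof
    show "span (r ` C) \<subseteq> D"
      using r D by (intro span_minimal) auto
    show "D \<subseteq> span (r ` C)"
    proof
      fix d assume d: "d \<in> D"
      then have "d +o U \<in> quotient_span scale U C"
        using span \<open>D \<subseteq> A\<close> by (auto simp: quotient_space_def)
      then obtain c F where F: "finite F" "F \<subseteq> C" "d +o U = quotient_lincomb scale U c F"
        by (auto simp: quotient_span_def)
      let ?s = "\<Sum>X\<in>F. scale (c X) (r X)"
      \<comment> \<open>Both \<open>d\<close> and \<open>?s\<close> represent the same coset and lie
        in \<open>D\<close>, so their difference is in \<open>U \<inter> D = {0}\<close>.\<close>
      have "d - ?s \<in> U"
        using F lc coset_eq_iff[OF U] by metis
      moreover have "d - ?s \<in> D"
        using d r F by (intro subspace_diff subspace_sum subspace_scale D) auto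
      ultimately have "d = ?s"
        using UD by force
      moreover have "?s \<in> span (r ` C)"
        using F by (intro span_sum span_scale span_base) auto
      ultimately show "d \<in> span (r ` C)"
        by simp
    qed
  qed
  ultimately have "basis_of scale D (r ` C)"
    using r by (auto simp: basis_of_def)
  then have "|r ` C| =o cdim scale D"
    by (rule basis_of_ordIso_cdim)
  with inj have "|C| =o cdim scale D"
    by (rule ordIso_transitive[OF card_of_ordIsoI[OF inj_on_imp_bij_betw]])
  then show ?thesis
    by (simp add: quotient_cdim_def C_def)
qed

section \<open>Invariance of dimensions under injective linear maps\<close>

lemma cdim_linear_image:
  assumes g: "Vector_Spaces.linear scale scale g" and A: "subspace A" and inj: "inj_on g A"
  shows "cdim scale A =o cdim scale (g ` A)"
proof -
  interpret g: linear scale scale g by fact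
  obtain B where B: "basis_of scale A B"
    using ex_basis_of[OF A] by blast
  then have "basis_of scale (g ` A) (g ` B)"
    using inj g.independent_injective_image[of B] g.span_image[of B] by (auto simp: basis_of_def)
  then have 1: "|g ` B| =o cdim scale (g ` A)"
    by (rule basis_of_ordIso_cdim)
  have "inj_on g B"
    using inj B inj_on_subset by (auto simp: basis_of_def)
  then have 2: "|B| =o |g ` B|"
    by (intro card_of_ordIsoI[OF inj_on_imp_bij_betw])
  from ordIso_transitive[OF 2 1] show ?thesis
    by (rule ordIso_transitive[OF ordIso_symmetric[OF basis_of_ordIso_cdim[OF B]]])
qed

lemma linear_image_set_plus:
  assumes "Vector_Spaces.linear scale scale g"
  shows "g ` (U + D) = g ` U + g ` D"
proof -
  interpret g: linear scale scale g by fact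
  show ?thesis
  proof
    show "g ` (U + D) \<subseteq> g ` U + g ` D"
      by (auto simp: g.add elim!: set_plus_elim intro!: set_plus_intro)
    show "g ` U + g ` D \<subseteq> g ` (U + D)"
      by (auto simp flip: g.add elim!: set_plus_elim intro!: imageI set_plus_intro)
  qed
qed

lemma direct_sum_linear_image:
  assumes g: "Vector_Spaces.linear scale scale g" and inj: "inj g" and "direct_sum A U D"
  shows "direct_sum (g ` A) (g ` U) (g ` D)"
proof -
  interpret g: linear scale scale g by fact
  have "g ` U \<inter> g ` D = g ` (U \<inter> D)"
    using inj by (simp add: image_Int)
  moreover have "g ` U + g ` D = g ` (U + D)"
    using linear_image_set_plus[OF g] by simp
  ultimately show ?thesis
    using assms(3) g.zero by (auto simp: direct_sum_def g.subspace_image)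
qed

lemma quotient_cdim_linear_image:
  assumes g: "Vector_Spaces.linear scale scale g" and inj: "inj g"
    and "subspace U" "subspace A" "U \<subseteq> A"
  shows "quotient_cdim scale (g ` A) (g ` U) =o quotient_cdim scale A U"
proof -
  obtain D where D: "direct_sum A U D"
    using ex_direct_sum assms by blast
  then have 1: "quotient_cdim scale A U =o cdim scale D"
    by (rule quotient_cdim_direct_sum)
  have 2: "cdim scale D =o cdim scale (g ` D)"
    using D g inj by (intro cdim_linear_image) (auto simp: direct_sum_def intro: inj_on_subset)
  have 3: "quotient_cdim scale (g ` A) (g ` U) =o cdim scale (g ` D)"
    using direct_sum_linear_image[OF g inj D] by (rule quotient_cdim_direct_sum)
  show ?thesis
    by (rule ordIso_transitive[OF 3 ordIso_symmetric[OF ordIso_transitive[OF 1 2]]])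
qed

section \<open>Construction of isomorphisms from bases and direct sums\<close>

lemma ex_linear_of_cdim_eq:
  assumes D: "subspace D" and E: "subspace E" and eq: "cdim scale D =o cdim scale E"
  shows "\<exists>h. Vector_Spaces.linear scale scale h \<and> bij_betw h D E"
proof -
  interpret p: vector_space_pair scale scale ..
  obtain B C where B: "basis_of scale D B" and C: "basis_of scale E C"
    using ex_basis_of D E by blast
  have "|B| =o |C|"
    by (rule ordIso_transitive[OF basis_of_ordIso_cdim[OF B]
          ordIso_transitive[OF eq ordIso_symmetric[OF basis_of_ordIso_cdim[OF C]]]])
  then obtain k where k: "bij_betw k B C"
    by (auto simp flip: card_of_ordIso)
  obtain h where h: "Vector_Spaces.linear scale scale h" "\<And>b. b \<in> B \<Longrightarrow> h b = k b"
    using p.linear_independent_extend[of B k] B by (auto simp: basis_of_def)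
  interpret h: linear scale scale h by fact
  have hk: "bij_betw h B C"
    using k h(2) by (simp cong: bij_betw_cong)
  \<comment> \<open>As \<open>h\<close> maps the basis \<open>B\<close> bijectively onto the
    independent set \<open>C\<close>, it is injective on \<open>span B\<close>.\<close>
  then have "h ` span B = span C"
    by (simp add: h.span_image[symmetric] bij_betw_def)
  moreover have "inj_on h (span B)"
    using hk C by (intro h.inj_on_span_independent_image) (auto simp: basis_of_def bij_betw_def)
  ultimately have "bij_betw h D E"
    using B C by (auto simp: basis_of_def bij_betw_def)
  with h show ?thesis
    by blast
qed

lemma ex_linear_eq_on_direct_sum:
  assumes UD: "direct_sum A U D" and g: "Vector_Spaces.linear scale scale g" and k: "Vector_Spaces.linear scale scale k"
  shows "\<exists>h. Vector_Spaces.linear scale scale h \<and> (\<forall>x\<in>U. h x = g x) \<and> (\<forall>x\<in>D. h x = k x)"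
proof -
  interpret p: vector_space_pair scale scale ..
  obtain B C where BC: "basis_of scale U B" "basis_of scale D C"
    using ex_basis_of UD by (meson direct_sum_def)
  then have ind: "independent B" "independent C" and Int: "span B \<inter> span C = {0}"
    using UD by (simp_all add: basis_of_def direct_sum_def)
  then have "independent (B \<union> C)"
    by (rule independent_Un_span_Int)
  \<comment> \<open>Disjointness of the bases lets values on \<open>B\<close> and on
    \<open>C\<close> be prescribed independently: the case distinction below then gives
    \<open>k\<close> on all of \<open>C\<close>.\<close>
  have "B \<inter> C \<subseteq> {0}" and "0 \<notin> B"
    using Int span_superset[of B] span_superset[of C] ind(1) dependent_zero[of B] by blast+
  then have "B \<inter> C = {}"
    by blast
  obtain h where h: "Vector_Spaces.linear scale scale h"
      "\<forall>b\<in>B \<union> C. h b = (if b \<in> B then g b else k b)"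
    using p.linear_independent_extend[OF \<open>independent (B \<union> C)\<close>,
        of "\<lambda>b. if b \<in> B then g b else k b"] by (elim exE conjE)
  have "h x = g x" if "x \<in> U" for x
  proof (rule p.linear_eq_on[OF h(1) g])
    show "x \<in> span B"
      using that BC(1) by (simp add: basis_of_def)
    show "h b = g b" if "b \<in> B" for b
      using that h(2) by simp
  qed
  moreover have "h x = k x" if "x \<in> D" for x
  proof (rule p.linear_eq_on[OF h(1) k])
    show "x \<in> span C"
      using that BC(2) by (simp add: basis_of_def)
    show "h b = k b" if "b \<in> C" for b
      using that h(2) \<open>B \<inter> C = {}\<close> by auto
  qed
  ultimately show ?thesis
    using h(1) by blast
qed

lemma ex_linear_extend_direct_sum:
  assumes g: "Vector_Spaces.linear scale scale g" and bij: "bij_betw g U U'"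
    and UD: "direct_sum A U D" and UD': "direct_sum A' U' D'"
    and eq: "cdim scale D =o cdim scale D'"
  shows "\<exists>h. Vector_Spaces.linear scale scale h \<and> bij_betw h A A' \<and> (\<forall>x\<in>U. h x = g x) \<and> h ` D = D'"
proof -
  from UD have sub: "subspace U" "subspace D" and A: "A = U + D"
    by (auto simp: direct_sum_def)
  from UD' have Int': "U' \<inter> D' = {0}" and D': "subspace D'" and A': "A' = U' + D'"
    by (auto simp: direct_sum_def)
  obtain k where k: "Vector_Spaces.linear scale scale k" "bij_betw k D D'"
    using ex_linear_of_cdim_eq[OF sub(2) D' eq] by blast
  obtain h where h: "Vector_Spaces.linear scale scale h" "\<forall>x\<in>U. h x = g x" "\<forall>x\<in>D. h x = k x"
    using ex_linear_eq_on_direct_sum[OF UD g k(1)] by blast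
  interpret h: linear scale scale h by fact
  have hU: "bij_betw h U U'" and hD: "bij_betw h D D'"
    using bij k(2) h(2,3) by (simp_all cong: bij_betw_cong)
  have "h ` (U + D) = h ` U + h ` D"
    by (rule linear_image_set_plus[OF h(1)])
  then have "h ` A = A'"
    using hU hD A A' by (simp add: bij_betw_def)
  moreover have "inj_on h A"
  proof -
    have "x = 0" if "x \<in> A" "h x = 0" for x
    proof -
      obtain u d where ud: "u \<in> U" "d \<in> D" "x = u + d"
        using \<open>x \<in> A\<close> A by (auto simp: set_plus_def)
      have hu: "h u = - h d"
        using \<open>h x = 0\<close> ud by (simp add: h.add eq_neg_iff_add_eq_0)
      have "h u \<in> U'" "h d \<in> D'"
        using ud hU hD by (auto simp: bij_betw_def)
      then have "h u = 0"
        using Int' subspace_neg[OF D'] hu by (metis Int_iff singletonD)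
      then have "h d = 0"
        using hu by simp
      have "u = 0"
        using \<open>h u = 0\<close> h.inj_on_iff_eq_0[OF sub(1)] hU ud(1) by (simp add: bij_betw_def)
      moreover have "d = 0"
        using \<open>h d = 0\<close> h.inj_on_iff_eq_0[OF sub(2)] hD ud(2) by (simp add: bij_betw_def)
      ultimately show "x = 0"
        using ud by simp
    qed
    then show ?thesis
      using A subspace_set_plus[OF sub] by (simp add: h.inj_on_iff_eq_0)
  qed
  ultimately show ?thesis
    using h hD by (auto simp: bij_betw_def)
qed

section \<open>Transversals of kernels and null spaces\<close>

lemma transversal_ker_rel_iff:
  "transversal U (ker_rel U h) T \<longleftrightarrow> T \<subseteq> U \<and> inj_on h T \<and> h ` T = h ` U"
proof -
  have cosets: "ker_rel U h `` {x} = {y \<in> U. h y = h x}" if "x \<in> U" for x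
    using that by (auto simp: ker_rel_def)
  have "U // ker_rel U h = (\<lambda>x. {y \<in> U. h y = h x}) ` U"
    using cosets by (auto simp: quotient_def)
  then have "transversal U (ker_rel U h) T \<longleftrightarrow>
      T \<subseteq> U \<and> (\<forall>x\<in>U. \<exists>!t. t \<in> U \<and> h t = h x \<and> t \<in> T)"
    by (simp add: transversal_def)
  \<comment> \<open>The classes are the nonempty fibres of \<open>h\<close> on \<open>U\<close>.
    Injectivity on \<open>T\<close> means at most one point of \<open>T\<close> in each fibre,
    equality of the images at least one.\<close>
  also have "\<dots> \<longleftrightarrow> T \<subseteq> U \<and> inj_on h T \<and> h ` T = h ` U"
  proof (rule conj_cong[OF refl], intro iffI conjI)
    assume T: "T \<subseteq> U" and ex1: "\<forall>x\<in>U. \<exists>!t. t \<in> U \<and> h t = h x \<and> t \<in> T"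
    show "inj_on h T"
    proof (rule inj_onI)
      fix s t assume "s \<in> T" "t \<in> T" "h s = h t"
      then show "s = t"
        using bspec[OF ex1, of t] T by blast
    qed
    show "h ` T = h ` U"
    proof
      show "h ` T \<subseteq> h ` U"
        using T by (rule image_mono)
      show "h ` U \<subseteq> h ` T"
        using ex1 by (metis image_eqI image_subsetI)
    qed
  next
    assume T: "T \<subseteq> U" and h: "inj_on h T \<and> h ` T = h ` U"
    show "\<forall>x\<in>U. \<exists>!t. t \<in> U \<and> h t = h x \<and> t \<in> T"
    proof
      fix x assume "x \<in> U"
      then have "h x \<in> h ` T"
        using h by simp
      then obtain t where t: "t \<in> T" "h t = h x"
        by force
      show "\<exists>!t. t \<in> U \<and> h t = h x \<and> t \<in> T"
      proof (rule ex1I[of _ t])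
        show "t \<in> U \<and> h t = h x \<and> t \<in> T"
          using t T by blast
        show "s = t" if "s \<in> U \<and> h s = h x \<and> s \<in> T" for s
          using that t h by (simp add: inj_on_def)
      qed
    qed
  qed
  finally show ?thesis .
qed

text \<open>Given \<open>x\<close> in \<open>U\<close>, take \<open>t\<close> in \<open>T\<close>
  with \<open>h t = h x\<close> and write \<open>x = t + (x - t)\<close>. By the previous
  characterization the hypotheses say that the subspace \<open>T\<close> is a transversal of the
  kernel of \<open>h\<close> on \<open>U\<close>.\<close>

lemma direct_sum_null_space:
  assumes h: "Vector_Spaces.linear scale scale h" and U: "subspace U" and T: "subspace T" "T \<subseteq> U"
    and inj: "inj_on h T" and im: "h ` T = h ` U"
  shows "direct_sum U T (null_space U h)"
proof -
  interpret h: linear scale scale h by fact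
  let ?N = "null_space U h"
  have "subspace ?N"
    using U h.subspace_kernel subspace_inter[of U "{x. h x = 0}"]
    by (simp add: null_space_def Collect_conj_eq)
  moreover have "T \<inter> ?N = {0}"
    using inj T(2) h.inj_on_iff_eq_0[OF T(1)] subspace_0[OF T(1)] subspace_0[OF U] h.zero
    by (auto simp: null_space_def)
  moreover have "T + ?N = U"
  proof
    show "T + ?N \<subseteq> U"
      using T U by (auto simp: set_plus_def null_space_def intro!: subspace_add)
    show "U \<subseteq> T + ?N"
    proof
      fix x assume x: "x \<in> U"
      then obtain t where t: "t \<in> T" "h t = h x"
        using im by (metis image_iff)
      then have "x - t \<in> ?N"
        using T x U by (auto simp: null_space_def h.diff intro!: subspace_diff)
      then have "t + (x - t) \<in> T + ?N"
        using t(1) by (intro set_plus_intro)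
      then show "x \<in> T + ?N"
        by simp
    qed
  qed
  ultimately show ?thesis
    using T by (simp add: direct_sum_def)
qed

section \<open>Units and unit-regular elements\<close>

lemma Units_Lbar_iff:
  "u \<in> Units (Lbar scale W) \<longleftrightarrow> Vector_Spaces.linear scale scale u \<and> bij u \<and> u ` W = W"
proof
  assume "u \<in> Units (Lbar scale W)"
  then obtain v where u: "Vector_Spaces.linear scale scale u" "u ` W \<subseteq> W" and v: "v ` W \<subseteq> W"
      and uv: "v \<circ> u = id" "u \<circ> v = id"
    by (auto simp: Units_def Lbar_def)
  have "W = u ` v ` W"
    using uv(2) by (simp add: image_comp)
  also have "\<dots> \<subseteq> u ` W"
    using v by (rule image_mono)
  finally have "u ` W = W"
    using u(2) by (rule subset_antisym[rotated])
  with u(1) o_bij[OF uv] show "Vector_Spaces.linear scale scale u \<and> bij u \<and> u ` W = W"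
    by (intro conjI)
next
  assume u: "Vector_Spaces.linear scale scale u \<and> bij u \<and> u ` W = W"
  interpret p: vector_space_pair scale scale ..
  obtain v where v: "Vector_Spaces.linear scale scale v" "v \<circ> u = id"
    using p.linear_injective_left_inverse[of u] u by (auto simp: bij_is_inj)
  have "v ` u ` W = W"
    using v(2) by (simp add: image_comp)
  then have "v ` W = W"
    using u by simp
  moreover have "u \<circ> v = id"
  proof
    fix y
    obtain x where "y = u x"
      using u bij_is_surj surjD by metis
    then show "(u \<circ> v) y = id y"
      using fun_cong[OF v(2), of x] by simp
  qed
  ultimately show "u \<in> Units (Lbar scale W)"
    using u v by (auto simp: Units_def Lbar_def)
qed

lemma unit_regular_Lbar_iff:
  "unit_regular (Lbar scale W) f \<longleftrightarrow>
    f \<in> carrier (Lbar scale W) \<and>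
    (\<exists>u. Vector_Spaces.linear scale scale u \<and> bij u \<and> u ` W = W \<and> (\<forall>x. f (u (f x)) = f x))"
  unfolding unit_regular_def Bex_def Units_Lbar_iff by (auto simp: Lbar_def fun_eq_iff)

end

theorem theorem4p6:
  fixes scale :: "'a::field \<Rightarrow> 'b::ab_group_add \<Rightarrow> 'b"
    and W :: "'b set"
    and f :: "'b \<Rightarrow> 'b"
  assumes "vector_space scale"
    and "module.subspace scale W"
    and "f \<in> carrier (Lbar scale W)"
  shows "unit_regular (Lbar scale W) f \<longleftrightarrow>
    range_of W (restrict f W) = W \<inter> range_of UNIV f \<and>
    nullity scale W (restrict f W) =o corank scale W (restrict f W) \<and>
    (\<exists>T. module.subspace scale T \<and>
         transversal UNIV (ker_rel UNIV f) T \<and>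
         transversal W (ker_rel W (restrict f W)) (W \<inter> T) \<and>
         codim scale (W + T) =o codim scale (W + range_of UNIV f))"
proof -
  interpret vector_space scale by fact
  interpret p: vector_space_pair scale scale ..
  note W = assms(2)
  have f: "Vector_Spaces.linear scale scale f" and fW: "f ` W \<subseteq> W"
    using assms(3) by (auto simp: Lbar_def)
  interpret f: linear scale scale f by fact
  define N where "N = null_space W f"
  define R where "R = range f"
  have R: "subspace R" and fWs: "subspace (f ` W)"
    using W by (auto simp: R_def f.subspace_image)
  have WR: "subspace (W + R)"
    using W R by (rule subspace_set_plus)
  \<comment> \<open>Outside \<open>W\<close> the function \<open>restrict f W\<close> is
    \<open>undefined\<close>, but only its values on \<open>W\<close> enter, so \<open>f\<close>
    itself can replace it.\<close>
  have nul: "nullity scale W (restrict f W) = cdim scale N"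
    unfolding nullity_def N_def null_space_def by (rule arg_cong[of _ _ "cdim scale"]) auto
  have cor: "corank scale W (restrict f W) = quotient_cdim scale W (f ` W)"
    by (simp add: corank_def range_of_def)
  have trV: "transversal UNIV (ker_rel UNIV f) T \<longleftrightarrow> inj_on f T \<and> f ` T = R" for T
    by (simp add: transversal_ker_rel_iff R_def)
  have trW: "transversal W (ker_rel W (restrict f W)) (W \<inter> T) \<longleftrightarrow>
      inj_on f (W \<inter> T) \<and> f ` (W \<inter> T) = f ` W" for T
  proof -
    have "ker_rel W (restrict f W) = ker_rel W f"
      by (auto simp: ker_rel_def)
    then show ?thesis
      by (simp add: transversal_ker_rel_iff)
  qed
  have "unit_regular (Lbar scale W) f \<longleftrightarrow>
    f ` W = W \<inter> R \<and> cdim scale N =o quotient_cdim scale W (f ` W) \<and>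
    (\<exists>T. subspace T \<and> (inj_on f T \<and> f ` T = R) \<and>
         (inj_on f (W \<inter> T) \<and> f ` (W \<inter> T) = f ` W) \<and>
         quotient_cdim scale UNIV (W + T) =o quotient_cdim scale UNIV (W + R))"
    (is "_ \<longleftrightarrow> ?i \<and> ?ii \<and> (\<exists>T. ?iii T)")
  proof

    \<comment> \<open>From a unit to the three conditions\<close>
    assume "unit_regular (Lbar scale W) f"
    then obtain u where u: "Vector_Spaces.linear scale scale u" "bij u" "u ` W = W"
        and fu: "\<And>x. f (u (f x)) = f x"
      by (auto simp: unit_regular_Lbar_iff)
    interpret u: linear scale scale u by fact
    have i: ?i
    proof
      show "f ` W \<subseteq> W \<inter> R"
        using fW by (auto simp: R_def)
      show "W \<inter> R \<subseteq> f ` W"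
      proof
        fix w assume w: "w \<in> W \<inter> R"
        \<comment> \<open>The map \<open>f \<circ> u\<close> is the identity on \<open>R\<close>,
          and \<open>u w\<close> is again in \<open>W\<close>.\<close>
        then have "w = f (u w)"
          using fu by (auto simp: R_def)
        then show "w \<in> f ` W"
          using w u(3) by blast
      qed
    qed
    have inj: "inj_on f (u ` R)"
      using fu by (auto simp: R_def inj_on_def)
    have img: "f ` u ` f ` S = f ` S" for S
      by (simp add: image_image fu)
    \<comment> \<open>Since \<open>W = u\<close>
      W\<open>and\<close>u\<open>is injective, the left side is\<close>u
      \<open>(W \<inter> R)\<close>, and (i) applies.\<close>
    have WuR: "W \<inter> u ` R = u ` f ` W"
      using u(2,3) i by (metis bij_is_inj image_Int)
    have injW: "inj_on f (u ` f ` W)"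
      using inj by (rule inj_on_subset) (auto simp: R_def)
    have "direct_sum W (u ` f ` W) (null_space W f)"
      using f W fWs fW u(3) injW img by (intro direct_sum_null_space u.subspace_image) auto
    then have 1: "quotient_cdim scale W (u ` f ` W) =o cdim scale N"
      unfolding N_def by (rule quotient_cdim_direct_sum)
    have "quotient_cdim scale (u ` W) (u ` f ` W) =o quotient_cdim scale W (f ` W)"
      using u W fWs fW by (intro quotient_cdim_linear_image) (auto simp: bij_is_inj)
    then have 2: "quotient_cdim scale W (u ` f ` W) =o quotient_cdim scale W (f ` W)"
      by (simp only: u(3))
    have ii: ?ii
      by (rule ordIso_transitive[OF ordIso_symmetric[OF 1] 2])
    have "u ` (W + R) = W + u ` R"
      using linear_image_set_plus[OF u(1)] u(3) by simp
    then have "quotient_cdim scale UNIV (W + u ` R) =o quotient_cdim scale UNIV (W + R)"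
      using quotient_cdim_linear_image[OF u(1) _ WR subspace_UNIV] u(2)
      by (simp add: bij_is_inj bij_is_surj)
    moreover have "f ` u ` R = R"
      unfolding R_def by (rule img)
    ultimately have "?iii (u ` R)"
      unfolding WuR using u.subspace_image[OF R] inj injW img by (intro conjI)
    then have "\<exists>T. ?iii T"
      by (rule exI[of ?iii "u ` R"])
    with i ii show "?i \<and> ?ii \<and> (\<exists>T. ?iii T)"
      by (intro conjI)
  next

    \<comment> \<open>From the three conditions to a unit\<close>
    assume "?i \<and> ?ii \<and> (\<exists>T. ?iii T)"
    then obtain T where i: ?i and ii: ?ii and T: "subspace T"
        and inj: "inj_on f T" and fT: "f ` T = R" and fWT: "f ` (W \<inter> T) = f ` W"
        and codim: "quotient_cdim scale UNIV (W + T) =o quotient_cdim scale UNIV (W + R)"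
      by blast
    \<comment> \<open>On \<open>R\<close>, \<open>g\<close> is the inverse of the bijection
      \<open>f : T \<rightarrow> R\<close>; its values elsewhere are irrelevant.\<close>
    obtain g where g: "Vector_Spaces.linear scale scale g" and gf: "\<And>x. x \<in> T \<Longrightarrow> g (f x) = x"
      using p.linear_exists_left_inverse_on[OF f T inj] by blast
    have gRT: "bij_betw g R T"
      using gf fT by (intro bij_betw_byWitness[where f' = f]) auto
    have gWT: "g ` f ` W = W \<inter> T"
      using gf unfolding fWT[symmetric] by force
    have WT: "direct_sum W (W \<inter> T) N"
      unfolding N_def using W T f inj fWT
      by (intro direct_sum_null_space subspace_inter) (auto intro: inj_on_subset)
    obtain C where C: "direct_sum W (f ` W) C"
      using ex_direct_sum[OF fWs W fW] by blast
    \<comment> \<open>The dimension of \<open>C\<close> is the corank, so this is (ii).\<close>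
    have "cdim scale C =o cdim scale N"
      by (rule ordIso_symmetric[OF ordIso_transitive[OF ii quotient_cdim_direct_sum[OF C]]])
    have enlarge: "direct_sum (W + S) S E" if "direct_sum W (W \<inter> S) E" "subspace S" for S E
    proof -
      have E: "subspace E" "W \<inter> S \<inter> E = {0}" and WSE: "W \<inter> S + E = W"
        using that by (auto simp: direct_sum_def)
      have "E \<subseteq> W"
        using WSE subspace_0[OF W] subspace_0[OF \<open>subspace S\<close>]
        by (metis IntI set_zero_plus2)
      then have "S \<inter> E = {0}"
        using E by blast
      moreover have "S + S = S"
        using coset_add[OF \<open>subspace S\<close>, of 0 0] by simp
      moreover have "W \<inter> S + S = S"
        using \<open>S + S = S\<close> subspace_0[OF W] subspace_0[OF \<open>subspace S\<close>]
        by (metis Int_lower2 IntI set_plus_mono2 set_zero_plus2 subset_antisym order_refl)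
      then have "W + S = S + E"
        using WSE by (metis add.commute add.left_commute)
      ultimately show ?thesis
        using E that by (simp add: direct_sum_def)
    qed
    have RC: "direct_sum (W + R) R C" and TN: "direct_sum (W + T) T N"
      using enlarge C WT R T i by auto
    obtain h where h: "Vector_Spaces.linear scale scale h" "bij_betw h (W + R) (W + T)"
        and hg: "\<forall>x\<in>R. h x = g x" and hC: "h ` C = N"
      using ex_linear_extend_direct_sum[OF g gRT RC TN \<open>cdim scale C =o cdim scale N\<close>] by blast
    interpret h: linear scale scale h by fact
    have hW: "h ` W = W"
    proof -
      have "h ` f ` W = W \<inter> T"
        using hg gWT by (auto simp: R_def image_image)
      then show ?thesis
        using linear_image_set_plus[OF h(1), of "f ` W" C] C WT hC by (simp add: direct_sum_def)
    qed
    have "subspace (W + T)"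
      using W T by (rule subspace_set_plus)
    then obtain D D' where D: "direct_sum UNIV (W + R) D" and D': "direct_sum UNIV (W + T) D'"
      using ex_direct_sum[OF _ subspace_UNIV] WR by blast
    have "cdim scale D =o cdim scale D'"
      by (rule ordIso_transitive[OF ordIso_symmetric[OF quotient_cdim_direct_sum[OF D]]
            ordIso_transitive[OF ordIso_symmetric[OF codim] quotient_cdim_direct_sum[OF D']]])
    then obtain u where u: "Vector_Spaces.linear scale scale u" "bij u" and uh: "\<forall>x\<in>W + R. u x = h x"
      using ex_linear_extend_direct_sum[OF h D D'] by blast
    have "W \<subseteq> W + R" and "R \<subseteq> W + R"
      using subspace_0[OF W] subspace_0[OF R] set_zero_plus2[of W R] set_zero_plus2[of R W]
      by (auto simp: add.commute)
    have "u ` W = W"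
      using uh \<open>W \<subseteq> W + R\<close> hW by (metis image_cong subsetD)
    \<comment> \<open>With \<open>f x = f t\<close> and \<open>t\<close> in \<open>T\<close>,
      \<open>u (f x) = g (f t) = t\<close>, and \<open>f\<close> returns this to
      \<open>f x\<close>.\<close>
    moreover have "f (u (f x)) = f x" for x
    proof -
      obtain t where t: "t \<in> T" "f x = f t"
        using fT unfolding R_def by blast
      have "f x \<in> R"
        by (simp add: R_def)
      with \<open>R \<subseteq> W + R\<close> have "f x \<in> W + R"
        by (rule subsetD)
      then have "u (f x) = g (f x)"
        using bspec[OF uh, of "f x"] bspec[OF hg \<open>f x \<in> R\<close>] by simp
      then show ?thesis
        using t gf by simp
    qed
    ultimately show "unit_regular (Lbar scale W) f"
      using u assms(3) by (auto simp: unit_regular_Lbar_iff)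
  qed
  then show ?thesis
    unfolding nul cor trV trW codim_def by (simp add: range_of_def R_def)
qed

end
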